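(* Let $K$ be a finite simplicial complex with vertex set $V$, $|V|=n$, and let $f\colon V\to\{1,\dots,n\}$ be an order function (a bijection). Then the colex vector field $F_f$ induced by $f$ is a discrete vector field on $K$; that is, no simplex of $K$ is in more than one pair of $F_f$.
   Context: Simplices are nonempty finite subsets of $V$; $K$ is closed under taking nonempty subsets. For $\sigma\in K$, the candidate list is $V_\sigma=\{v\in V\mid\{v\}\cup\sigma\in K\}$ and the candidate vertex is $c_f(\sigma)=\operatorname{argmin}_{v\in V_\sigma}f(v)$. The colex vector field $F_f$ is the collection of pairs (arrows) $\{\alpha\to\beta\}$ of simplices of $K$ of dimensions $p$ and $p+1$ (any $p\ge0$) such that $\beta=\{c_f(\alpha)\}\cup\alpha$ and $c_f(\alpha)\notin\alpha$. A discrete vector field on $K$ is a collection of pairs $\{\alpha^{(p)}<\beta^{(p+1)}\}$ of simplices of $K$, with $\alpha$ a face of $\beta$ of dimension one less, such that no simplex is in more than one pair. *)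

theory Defs
  imports Main
begin

(* The empty set is not a simplex.  The singletons {v}, v : V, are not required to
   belong to K; complexes in which every element of V is a 0-simplex are included
   as a special case. *)
definition simplicial_complex :: "'v set \<Rightarrow> 'v set set \<Rightarrow> bool" where
  "simplicial_complex V K \<longleftrightarrow>
     (\<forall>\<sigma>\<in>K. \<sigma> \<subseteq> V \<and> finite \<sigma> \<and> \<sigma> \<noteq> {}) \<and>
     (\<forall>\<sigma>\<in>K. \<forall>\<tau>. \<tau> \<subseteq> \<sigma> \<and> \<tau> \<noteq> {} \<longrightarrow> \<tau> \<in> K)"

(* Only meaningful for nonempty finite sets, where the subtraction does not truncate. *)
definition dimension :: "'v set \<Rightarrow> nat" where
  "dimension \<sigma> = card \<sigma> - 1"

definition candidates :: "'v set \<Rightarrow> 'v set set \<Rightarrow> 'v set \<Rightarrow> 'v set" where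
  "candidates V K \<sigma> = {v \<in> V. {v} \<union> \<sigma> \<in> K}"

definition candidate_vertex ::
  "'v set \<Rightarrow> 'v set set \<Rightarrow> ('v \<Rightarrow> nat) \<Rightarrow> 'v set \<Rightarrow> 'v" where
  "candidate_vertex V K f \<sigma> = arg_min_on f (candidates V K \<sigma>)"

(* An arrow \<alpha> \<rightarrow> \<beta> is the ordered pair (\<alpha>, \<beta>). *)
definition colex_vector_field ::
  "'v set \<Rightarrow> 'v set set \<Rightarrow> ('v \<Rightarrow> nat) \<Rightarrow> ('v set \<times> 'v set) set" where
  "colex_vector_field V K f =
     {(\<alpha>, \<beta>). \<alpha> \<in> K \<and> \<beta> \<in> K \<and> dimension \<beta> = dimension \<alpha> + 1 \<and>
              \<beta> = {candidate_vertex V K f \<alpha>} \<union> \<alpha> \<and> candidate_vertex V K f \<alpha> \<notin> \<alpha>}"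

(* The last conjunct: two pairs having a simplex in common, in either position, coincide. *)
definition discrete_vector_field :: "'v set set \<Rightarrow> ('v set \<times> 'v set) set \<Rightarrow> bool" where
  "discrete_vector_field K F \<longleftrightarrow>
     (\<forall>(\<alpha>, \<beta>)\<in>F. \<alpha> \<in> K \<and> \<beta> \<in> K \<and> \<alpha> \<subset> \<beta> \<and> dimension \<beta> = dimension \<alpha> + 1) \<and>
     (\<forall>\<sigma>\<in>K. \<forall>P\<in>F. \<forall>Q\<in>F. \<sigma> \<in> {fst P, snd P} \<and> \<sigma> \<in> {fst Q, snd Q} \<longrightarrow> P = Q)"

end

theory Submission
  imports Defs
begin

text \<open>
  If \<open>\<alpha> \<rightarrow> \<beta>\<close> is an arrow with new vertex \<open>c\<close>, then every candidate of \<open>\<beta>\<close> is a candidate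
  of \<open>\<alpha>\<close>, while \<open>c\<close> itself remains a candidate of \<open>\<beta>\<close>. Hence \<open>c\<close> is also the candidate vertex
  of \<open>\<beta>\<close>: so \<open>\<beta>\<close> is not the tail of an arrow, and \<open>\<alpha>\<close> is recovered from \<open>\<beta>\<close> by
  deleting the candidate vertex of \<open>\<beta>\<close>.
\<close>

text \<open>\<open>{v} \<union> \<alpha>\<close> is a nonempty face of
  \<open>{v} \<union> \<beta>\<close>, and \<open>K\<close> is closed under such faces.\<close>

lemma candidates_antimono:
  assumes "simplicial_complex V K" "\<alpha> \<subseteq> \<beta>"
  shows "candidates V K \<beta> \<subseteq> candidates V K \<alpha>"
proof
  fix v assume "v \<in> candidates V K \<beta>"
  then have v: "v \<in> V" "{v} \<union> \<beta> \<in> K"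
    by (simp_all add: candidates_def)
  have "\<forall>\<tau>. \<tau> \<subseteq> {v} \<union> \<beta> \<and> \<tau> \<noteq> {} \<longrightarrow> \<tau> \<in> K"
    using assms(1) v(2) unfolding simplicial_complex_def by (elim conjE bspec)
  moreover have "{v} \<union> \<alpha> \<subseteq> {v} \<union> \<beta>" "{v} \<union> \<alpha> \<noteq> {}"
    using assms(2) by auto
  ultimately have "{v} \<union> \<alpha> \<in> K"
    by blast
  with v(1) show "v \<in> candidates V K \<alpha>"
    by (simp add: candidates_def)
qed

lemma simplex_subset_candidates:
  assumes "simplicial_complex V K" "\<sigma> \<in> K"
  shows "\<sigma> \<subseteq> candidates V K \<sigma>"
proof
  fix v assume "v \<in> \<sigma>"
  moreover have "\<sigma> \<subseteq> V"
    using assms by (simp add: simplicial_complex_def)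
  ultimately show "v \<in> candidates V K \<sigma>"
    using assms(2) by (auto simp: candidates_def insert_absorb)
qed

text \<open>\<open>arg_min_on\<close> chooses some minimiser; injectivity of \<open>f\<close> on
  \<open>V\<close> leaves only one, so minimality identifies it with \<open>c\<close>.\<close>

lemma candidate_vertex_eqI:
  assumes "finite V" "inj_on f V"
    and "c \<in> candidates V K \<sigma>" "\<And>v. v \<in> candidates V K \<sigma> \<Longrightarrow> f c \<le> f v"
  shows "candidate_vertex V K f \<sigma> = c"
proof -
  have "finite (candidates V K \<sigma>)" "candidates V K \<sigma> \<noteq> {}"
    using assms(1,3) by (auto simp: candidates_def)
  from arg_min_if_finite[OF this, of f]
  have "candidate_vertex V K f \<sigma> \<in> candidates V K \<sigma>"
    and "f (candidate_vertex V K f \<sigma>) \<le> f c"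
    using assms(3) unfolding candidate_vertex_def by (auto simp: not_less)
  with assms(2-4) show ?thesis
    by (metis (no_types, lifting) candidates_def inj_onD mem_Collect_eq order_antisym)
qed

lemma candidate_vertex_insert:
  assumes "finite V" "simplicial_complex V K" "inj_on f V" "\<alpha> \<in> K"
    and c: "c = candidate_vertex V K f \<alpha>"
  shows "candidate_vertex V K f (insert c \<alpha>) = c"
proof -
  \<comment> \<open>The vertices of \<open>\<alpha>\<close> are themselves candidates, so the
    minimum over this finite set is attained.\<close>
  have "\<alpha> \<noteq> {}"
    using assms(2,4) by (simp add: simplicial_complex_def)
  then have "candidates V K \<alpha> \<noteq> {}"
    using simplex_subset_candidates[OF assms(2,4)] by blast
  moreover have "finite (candidates V K \<alpha>)"
    using assms(1) by (simp add: candidates_def)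
  moreover note arg_min_if_finite[of "candidates V K \<alpha>" f]
  ultimately
  have mem: "c \<in> candidates V K \<alpha>" and le: "\<And>v. v \<in> candidates V K \<alpha> \<Longrightarrow> f c \<le> f v"
    unfolding c candidate_vertex_def by (auto simp: not_less)
  show ?thesis
  proof (rule candidate_vertex_eqI[OF assms(1,3)])
    \<comment> \<open>\<open>{c} \<union> insert c \<alpha>\<close> collapses to
      \<open>{c} \<union> \<alpha>\<close>, already known to lie in \<open>K\<close>.\<close>
    show "c \<in> candidates V K (insert c \<alpha>)"
      using mem by (simp add: candidates_def)
    show "f c \<le> f v" if "v \<in> candidates V K (insert c \<alpha>)" for v
      using that le candidates_antimono[OF assms(2), of \<alpha> "insert c \<alpha>"] by blast
  qed
qed

theorem proposition3p5:
  fixes V :: "'v set" and K :: "'v set set" and f :: "'v \<Rightarrow> nat" and n :: nat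
  assumes "finite V" and "card V = n"
    and "simplicial_complex V K"
    and "bij_betw f V {1..n}"
  shows "discrete_vector_field K (colex_vector_field V K f)"
proof -
  let ?c = "candidate_vertex V K f" and ?F = "colex_vector_field V K f"
  have inj: "inj_on f V"
    using assms(4) by (rule bij_betw_imp_inj_on)
  have arrow: "\<beta> = insert (?c \<alpha>) \<alpha> \<and> ?c \<alpha> \<notin> \<alpha> \<and> ?c \<beta> = ?c \<alpha>" if "(\<alpha>, \<beta>) \<in> ?F" for \<alpha> \<beta>
    using that candidate_vertex_insert[OF assms(1,3) inj]
    by (auto simp: colex_vector_field_def)
  \<comment> \<open>The common vertex \<open>?c \<alpha> = ?c \<beta> = ?c \<alpha>'\<close> lies in
    neither tail, so \<open>insert_ident\<close> cancels it.\<close>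
  have same_head: "\<alpha> = \<alpha>'" if "(\<alpha>, \<beta>) \<in> ?F" "(\<alpha>', \<beta>) \<in> ?F" for \<alpha> \<alpha>' \<beta>
    using arrow[OF that(1)] arrow[OF that(2)] by (metis insert_ident)
  have same_tail: "\<beta> = \<beta>'" if "(\<alpha>, \<beta>) \<in> ?F" "(\<alpha>, \<beta>') \<in> ?F" for \<alpha> \<beta> \<beta>'
    using arrow[OF that(1)] arrow[OF that(2)] by simp
  \<comment> \<open>\<open>?c \<beta> = ?c \<alpha>\<close> lies in \<open>\<beta>\<close> by the
    first arrow and outside it by the second.\<close>
  have head_not_tail: False if "(\<alpha>, \<beta>) \<in> ?F" "(\<beta>, \<gamma>) \<in> ?F" for \<alpha> \<beta> \<gamma>
    using arrow[OF that(1)] arrow[OF that(2)] by (metis insertI1)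
  \<comment> \<open>The shared simplex is the tail of both arrows, the head of both, or the head of
    one and the tail of the other; the mixed cases are contradictory.\<close>
  have "P = Q" if "P \<in> ?F" "Q \<in> ?F" "\<sigma> \<in> {fst P, snd P}" "\<sigma> \<in> {fst Q, snd Q}" for P Q \<sigma>
    using that by (cases P; cases Q) (auto dest: same_head same_tail head_not_tail)
  then have "\<forall>\<sigma>\<in>K. \<forall>P\<in>?F. \<forall>Q\<in>?F. \<sigma> \<in> {fst P, snd P} \<and> \<sigma> \<in> {fst Q, snd Q} \<longrightarrow> P = Q"
    by (intro ballI impI) (elim conjE)
  moreover have "\<forall>(\<alpha>, \<beta>)\<in>?F. \<alpha> \<in> K \<and> \<beta> \<in> K \<and> \<alpha> \<subset> \<beta> \<and> dimension \<beta> = dimension \<alpha> + 1"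
    by (auto simp: colex_vector_field_def)
  ultimately show ?thesis
    unfolding discrete_vector_field_def by (intro conjI)
qed

end
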